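(* For $n\ge2$, the number of $1\underline{32}$-avoiding indecomposable permutations in $\mathfrak S_n$ is equal to the number of $1\underline{32}$-avoiding permutations $\pi=\pi_1\cdots\pi_n\in\mathfrak S_n$ that end with a rise, i.e. satisfy $\pi_{n-1}<\pi_n$.
   Context: For a permutation $\pi=\pi_1\cdots\pi_n$ of $[n]$, let $i_\pi$ be the smallest index $i$ with $\{\pi_1,\dots,\pi_i\}=\{1,\dots,i\}$; $\pi$ is indecomposable if $i_\pi=n$. A permutation $\pi$ contains the vincular pattern $1\underline{32}$ if there are indices $j<k<n$ with $\pi_j<\pi_{k+1}<\pi_k$; otherwise it avoids it. *)

theory Defs
  imports "HOL-Combinatorics.Permutations"
begin

text \<open>
  A permutation $\pi = \pi_1 \cdots \pi_n$ of $[n]$ is a function \<open>\<pi>\<close> with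
  \<open>\<pi> permutes {1..n}\<close>; its one-line entries are \<open>\<pi> 1, \<dots>, \<pi> n\<close>.
\<close>

text \<open>
  The index $i_\pi$. Indices range over $1, \ldots, n$, which excludes the empty prefix;
  for \<open>n \<ge> 1\<close> the index \<open>i = n\<close> always qualifies, so the minimum exists.
\<close>

definition first_block_end :: "nat \<Rightarrow> (nat \<Rightarrow> nat) \<Rightarrow> nat" where
  "first_block_end n \<pi> = (LEAST i. i \<in> {1..n} \<and> \<pi> ` {1..i} = {1..i})"

definition indecomposable :: "nat \<Rightarrow> (nat \<Rightarrow> nat) \<Rightarrow> bool" where
  "indecomposable n \<pi> \<longleftrightarrow> first_block_end n \<pi> = n"

definition contains_1_32 :: "nat \<Rightarrow> (nat \<Rightarrow> nat) \<Rightarrow> bool" where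
  "contains_1_32 n \<pi> \<longleftrightarrow>
     (\<exists>j k. 1 \<le> j \<and> j < k \<and> k < n \<and> \<pi> j < \<pi> (k + 1) \<and> \<pi> (k + 1) < \<pi> k)"

abbreviation avoids_1_32 :: "nat \<Rightarrow> (nat \<Rightarrow> nat) \<Rightarrow> bool" where
  "avoids_1_32 n \<pi> \<equiv> \<not> contains_1_32 n \<pi>"

definition ends_with_rise :: "nat \<Rightarrow> (nat \<Rightarrow> nat) \<Rightarrow> bool" where
  "ends_with_rise n \<pi> \<longleftrightarrow> \<pi> (n - 1) < \<pi> n"

end

theory Submission
  imports Defs
begin

text \<open>
  In an avoider every descent bottom is smaller than all earlier entries. Hence an avoider is
  decomposable iff its last entry is $n$, and it ends with a descent iff its last entry is $1$.
  Avoiders ending in $n$ and avoiders ending in $1$ are equinumerous: relabel the entries by the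
  cyclic shift of values $i \mapsto i + 1$, $n \mapsto 1$, which preserves the order
  of all entries but the last, and the last entry takes part in no occurrence of the pattern.
\<close>

text \<open>An earlier entry below the descent bottom would serve as the 1 of an occurrence whose 32
  is the descent itself; injectivity rules out equality.\<close>

lemma avoider_descent_bottom:
  assumes "\<pi> permutes {1..n}" "avoids_1_32 n \<pi>"
    and "1 \<le> k" "k < n" "\<pi> (k + 1) < \<pi> k" "1 \<le> j" "j \<le> k"
  shows "\<pi> (k + 1) < \<pi> j"
proof -
  have "\<pi> j \<noteq> \<pi> (k + 1)"
    using assms(7) by (simp add: inj_eq[OF permutes_inj[OF assms(1)]])
  moreover have "\<not> \<pi> j < \<pi> (k + 1)" if "j \<noteq> k"
    using assms(2-) that by (auto simp: contains_1_32_def)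
  ultimately show ?thesis
    using assms(5) by (cases "j = k") auto
qed

lemma first_block_end_props:
  assumes "\<pi> permutes {1..n}" "n \<ge> 1"
  shows "first_block_end n \<pi> \<in> {1..n}"
    and "\<pi> ` {1..first_block_end n \<pi>} = {1..first_block_end n \<pi>}"
proof -
  have "n \<in> {1..n} \<and> \<pi> ` {1..n} = {1..n}"
    using assms permutes_image by auto
  then have "first_block_end n \<pi> \<in> {1..n} \<and>
      \<pi> ` {1..first_block_end n \<pi>} = {1..first_block_end n \<pi>}"
    unfolding first_block_end_def by (rule LeastI)
  then show "first_block_end n \<pi> \<in> {1..n}"
    and "\<pi> ` {1..first_block_end n \<pi>} = {1..first_block_end n \<pi>}"
    by simp_all
qed

text \<open>A final \<open>n\<close> leaves a block of length \<open>n - 1\<close>. Conversely, a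
  proper initial block contains the value 1 but not the value \<open>n\<close>; if \<open>n\<close>
  is not in last place, the entry after it is a descent bottom preceded by 1, which cannot happen in
  an avoider.\<close>

lemma avoider_indecomposable_iff:
  assumes perm: "\<pi> permutes {1..n}" and avoids: "avoids_1_32 n \<pi>" and n: "n \<ge> 2"
  shows "indecomposable n \<pi> \<longleftrightarrow> \<pi> n \<noteq> n"
proof
  assume indec: "indecomposable n \<pi>"
  show "\<pi> n \<noteq> n"
  proof
    assume "\<pi> n = n"
    moreover have "{1..n - 1} = {1..n} - {n}"
      using n by auto
    ultimately have "\<pi> ` {1..n - 1} = {1..n - 1}"
      using permutes_image[OF perm] image_set_diff[OF permutes_inj[OF perm], of "{1..n}" "{n}"]
      by simp
    \<comment> \<open>As \<open>n \<ge> 2\<close>, the index \<open>n - 1\<close> is at least 1 and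
      so competes for the minimum.\<close>
    then have "first_block_end n \<pi> \<le> n - 1"
      unfolding first_block_end_def using n by (intro Least_le) auto
    with indec n show False
      by (simp add: indecomposable_def)
  qed
next
  assume last: "\<pi> n \<noteq> n"
  show "indecomposable n \<pi>"
  proof (rule ccontr)
    assume "\<not> indecomposable n \<pi>"
    moreover define i where "i = first_block_end n \<pi>"
    ultimately have i: "1 \<le> i" "i < n" "\<pi> ` {1..i} = {1..i}"
      using first_block_end_props[OF perm] n by (auto simp: indecomposable_def)
    have "1 \<in> \<pi> ` {1..i}"
      unfolding i(3) using i(1) by simp
    then obtain j where j: "j \<in> {1..i}" "\<pi> j = 1"
      by (rule imageE) simp
    have "n \<in> \<pi> ` {1..n}"
      unfolding permutes_image[OF perm] using n by simp
    then obtain m where m: "m \<in> {1..n}" "\<pi> m = n"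
      by (rule imageE) simp
    have "m \<noteq> n"
      using last m by auto
    then have "m < n"
      using m by auto
    have "i < m"
    proof (rule ccontr)
      assume "\<not> i < m"
      then have "\<pi> m \<in> \<pi> ` {1..i}"
        using m(1) by simp
      then show False
        unfolding i(3) using m(2) i(2) by simp
    qed
    \<comment> \<open>Since \<open>\<pi> m = n\<close> is the maximum, whatever follows it forms a
      descent.\<close>
    have "\<pi> (m + 1) \<in> {1..n}"
      unfolding permutes_in_image[OF perm] using \<open>m < n\<close> by simp
    moreover have "\<pi> (m + 1) \<noteq> \<pi> m"
      by (simp add: inj_eq[OF permutes_inj[OF perm]])
    ultimately have "\<pi> (m + 1) < \<pi> m"
      using m(2) by simp
    moreover have "1 \<le> m" "1 \<le> j" "j \<le> m"
      using \<open>i < m\<close> j(1) by auto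
    ultimately have "\<pi> (m + 1) < \<pi> j"
      using avoider_descent_bottom[OF perm avoids _ \<open>m < n\<close>] by blast
    with j(2) \<open>\<pi> (m + 1) \<in> {1..n}\<close> show False
      by simp
  qed
qed

text \<open>A final descent puts the last entry below all others, so it has to be 1; a final rise
  puts it above some entry, so it cannot be 1.\<close>

lemma avoider_ends_with_rise_iff:
  assumes perm: "\<pi> permutes {1..n}" and avoids: "avoids_1_32 n \<pi>" and n: "n \<ge> 2"
  shows "ends_with_rise n \<pi> \<longleftrightarrow> \<pi> n \<noteq> 1"
proof
  assume "ends_with_rise n \<pi>"
  moreover have "\<pi> (n - 1) \<in> {1..n}"
    unfolding permutes_in_image[OF perm] using n by auto
  ultimately show "\<pi> n \<noteq> 1"
    by (auto simp: ends_with_rise_def)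
next
  assume last: "\<pi> n \<noteq> 1"
  show "ends_with_rise n \<pi>"
  proof (rule ccontr)
    assume "\<not> ends_with_rise n \<pi>"
    moreover have "\<pi> (n - 1) \<noteq> \<pi> n"
      using n by (simp add: inj_eq[OF permutes_inj[OF perm]])
    ultimately have desc: "\<pi> (n - 1 + 1) < \<pi> (n - 1)"
      using n by (auto simp: ends_with_rise_def)
    have "1 \<in> \<pi> ` {1..n}"
      unfolding permutes_image[OF perm] using n by simp
    then obtain j where j: "j \<in> {1..n}" "\<pi> j = 1"
      by (rule imageE) simp
    then have "j \<le> n - 1"
      using last by (cases "j = n") auto
    then have "\<pi> (n - 1 + 1) < \<pi> j"
      using n j(1) by (intro avoider_descent_bottom[OF perm avoids _ _ desc]) auto
    then have "\<pi> n < 1"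
      using n j(2) by simp
    moreover have "\<pi> n \<in> {1..n}"
      unfolding permutes_in_image[OF perm] using n by simp
    ultimately show False
      by simp
  qed
qed

text \<open>The identity branch, which covers 0 when \<open>n \<ge> 1\<close>, makes this a
  permutation in the sense of \<open>permutes\<close>.\<close>

definition value_shift :: "nat \<Rightarrow> nat \<Rightarrow> nat" where
  "value_shift n i = (if i = n then 1 else if i \<in> {1..<n} then i + 1 else i)"

lemma value_shift_permutes:
  assumes "n \<ge> 1"
  shows "value_shift n permutes {1..n}"
proof (rule bij_imp_permutes)
  have "inj_on (value_shift n) {1..n}"
    by (auto simp: inj_on_def value_shift_def split: if_splits)
  moreover have "value_shift n ` {1..n} \<subseteq> {1..n}"
    using assms by (auto simp: value_shift_def)
  ultimately show "bij_betw (value_shift n) {1..n} {1..n}"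
    by (simp add: bij_betw_def endo_inj_surj)
qed (use assms in \<open>auto simp: value_shift_def\<close>)

text \<open>All entries before the last are below \<open>n\<close>, so the shift raises each of them
  by 1 and keeps their order. The last entry could only be the 2 of an occurrence.\<close>

lemma contains_value_shift_iff:
  assumes perm: "\<pi> permutes {1..n}" and last: "\<pi> n = n"
  shows "contains_1_32 n (value_shift n \<circ> \<pi>) \<longleftrightarrow> contains_1_32 n \<pi>"
proof -
  have range: "1 \<le> \<pi> i \<and> \<pi> i < n" if "1 \<le> i" "i < n" for i
  proof -
    have "\<pi> i \<noteq> n"
      using inj_eq[OF permutes_inj[OF perm], of i n] last that by simp
    then show ?thesis
      using permutes_in_image[OF perm, of i] that by auto
  qed
  have shift: "value_shift n (\<pi> i) = \<pi> i + 1" if "1 \<le> i" "i < n" for i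
    using range[OF that] by (auto simp: value_shift_def)
  have shift_last: "value_shift n (\<pi> n) = 1"
    using last by (simp add: value_shift_def)
  have "(\<pi> j < \<pi> (k + 1) \<and> \<pi> (k + 1) < \<pi> k) \<longleftrightarrow>
      (value_shift n (\<pi> j) < value_shift n (\<pi> (k + 1)) \<and>
       value_shift n (\<pi> (k + 1)) < value_shift n (\<pi> k))"
    if "1 \<le> j" "j < k" "k < n" for j k
  proof (cases "k + 1 = n")
    \<comment> \<open>Both sides are false: \<open>\<pi> n = n\<close> cannot lie below
      \<open>\<pi> k\<close>, and its shifted value 1 cannot lie above the shifted
      \<open>\<pi> j\<close>.\<close>
    case True
    then show ?thesis
      using that shift_last last range[of k] shift[of j] by auto
  next
    case False
    then show ?thesis
      using that shift[of j] shift[of k] shift[of "k + 1"] by auto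
  qed
  then show ?thesis
    unfolding contains_1_32_def comp_apply by blast
qed

lemma card_avoiders_last_top_eq_last_one:
  assumes "n \<ge> 1"
  shows "card {\<pi>. \<pi> permutes {1..n} \<and> avoids_1_32 n \<pi> \<and> \<pi> n = n} =
         card {\<pi>. \<pi> permutes {1..n} \<and> avoids_1_32 n \<pi> \<and> \<pi> n = 1}"
    (is "card ?A = card ?B")
proof -
  let ?c = "value_shift n"
  note c = value_shift_permutes[OF assms]
  have c_n: "?c n = 1"
    by (simp add: value_shift_def)
  have "bij_betw ((\<circ>) ?c) ?A ?B"
  proof (rule bij_betw_byWitness[where f' = "(\<circ>) (inv ?c)"])
    show "\<forall>\<pi>\<in>?A. inv ?c \<circ> (?c \<circ> \<pi>) = \<pi>"
      by (simp add: o_assoc permutes_inv_o[OF c])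
    show "\<forall>\<pi>\<in>?B. ?c \<circ> (inv ?c \<circ> \<pi>) = \<pi>"
      by (simp add: o_assoc permutes_inv_o[OF c])
    show "(\<circ>) ?c ` ?A \<subseteq> ?B"
      using contains_value_shift_iff c_n permutes_compose[OF _ c] by auto
    show "(\<circ>) (inv ?c) ` ?B \<subseteq> ?A"
    proof clarify
      fix \<sigma> assume \<sigma>: "\<sigma> permutes {1..n}" "avoids_1_32 n \<sigma>" "\<sigma> n = 1"
      let ?\<pi> = "inv ?c \<circ> \<sigma>"
      have perm: "?\<pi> permutes {1..n}"
        using permutes_compose[OF \<sigma>(1) permutes_inv[OF c]] .
      have last: "?\<pi> n = n"
        using \<sigma>(3) c_n permutes_inverses(2)[OF c, of n] by simp
      have "?c \<circ> ?\<pi> = \<sigma>"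
        by (simp add: o_assoc permutes_inv_o[OF c])
      \<comment> \<open>The equivalence is stated for permutations ending in \<open>n\<close>, so it
        is applied to the preimage \<open>?\<pi>\<close> rather than to
        \<open>\<sigma>\<close>.\<close>
      then have "avoids_1_32 n ?\<pi>"
        using contains_value_shift_iff[OF perm last] \<sigma>(2) by metis
      with perm last show "?\<pi> permutes {1..n} \<and> avoids_1_32 n ?\<pi> \<and> ?\<pi> n = n"
        by blast
    qed
  qed
  then show ?thesis
    by (rule bij_betw_same_card)
qed

theorem theorem4p4:
  fixes n :: nat
  assumes "n \<ge> 2"
  shows "card {\<pi>. \<pi> permutes {1..n} \<and> avoids_1_32 n \<pi> \<and> indecomposable n \<pi>} =
         card {\<pi>. \<pi> permutes {1..n} \<and> avoids_1_32 n \<pi> \<and> ends_with_rise n \<pi>}"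
proof -
  let ?Av = "{\<pi>. \<pi> permutes {1..n} \<and> avoids_1_32 n \<pi>}"
  let ?L = "\<lambda>v. {\<pi>. \<pi> permutes {1..n} \<and> avoids_1_32 n \<pi> \<and> \<pi> n = v}"
  have "finite {\<pi>. \<pi> permutes {1..n}}"
    by (simp add: finite_permutations)
  then have fin: "finite (?L v)" for v
    by (rule rev_finite_subset) blast
  \<comment> \<open>Both sets are complements within the avoiders, so it suffices to compare the
    removed sets \<open>?L n\<close> and \<open>?L 1\<close>.\<close>
  have "{\<pi>. \<pi> permutes {1..n} \<and> avoids_1_32 n \<pi> \<and> indecomposable n \<pi>} = ?Av - ?L n"
    using avoider_indecomposable_iff[OF _ _ assms] by blast
  moreover have "{\<pi>. \<pi> permutes {1..n} \<and> avoids_1_32 n \<pi> \<and> ends_with_rise n \<pi>} = ?Av - ?L 1"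
    using avoider_ends_with_rise_iff[OF _ _ assms] by blast
  moreover have "card (?Av - ?L v) = card ?Av - card (?L v)" for v
    by (rule card_Diff_subset[OF fin]) blast
  ultimately show ?thesis
    using card_avoiders_last_top_eq_last_one[OF order.trans[OF one_le_numeral assms]]
    by (simp only:)
qed

end
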